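(* For any constants $c\ge 1$ and $k\ge 3$ ($k$ an integer), there exists a $k$-tree $G$ such that no spanning subgraph $T$ of $G$ of treewidth less than or equal to $k-1$ is an additive $c$-spanner of $G$.
   Context: All graphs $G$ are connected, finite, undirected, loopless and without multiple edges; $\mathrm{dist}_G(u,v)$ is the number of edges of a shortest path between $u$ and $v$ in $G$. A spanning subgraph $T$ of $G$ is an additive $c$-spanner (also: $+c$ spanner) of $G$ if $\mathrm{dist}_T(u,v)\le \mathrm{dist}_G(u,v)+c$ for every pair of vertices $u,v$ of $G$. For an integer $k\ge 1$, the class of $k$-trees is defined recursively: (1) a $(k+1)$-clique is a $k$-tree; (2) if $G$ is a $k$-tree and $K$ is a $k$-clique of $G$, then adding a new vertex $z$ to $G$ together with all edges between $z$ and the vertices of $K$ gives a $k$-tree; and nothing else is a $k$-tree. *)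

theory Defs
  imports "Graph_Theory.Graph_Theory"
begin

text \<open>
  Finite simple undirected graphs are the finite, loopless, symmetric digraphs
  of the locale \<^locale>\<open>pair_graph\<close>: an undirected edge \<open>uv\<close> is
  represented by the two arcs \<open>(u,v)\<close> and \<open>(v,u)\<close>.
\<close>

section \<open>Distance and additive spanners\<close>

text \<open>
  Every arc has cost 1, so the cost of a walk is its number of edges. The
  distance is infinite between vertices in different components.
\<close>

definition gdist :: "'a pair_pre_digraph \<Rightarrow> 'a \<Rightarrow> 'a \<Rightarrow> ereal" where
  "gdist G u v = wf_digraph.\<mu> (with_proj G) (\<lambda>_. 1) u v"

text \<open>
  The condition \<open>pair_graph T\<close> makes sure that a subgraph contains both or
  none of the two arcs of an undirected edge.
\<close>

definition spanning_subgraph :: "'a pair_pre_digraph \<Rightarrow> 'a pair_pre_digraph \<Rightarrow> bool" where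
  "spanning_subgraph T G \<longleftrightarrow> pair_graph T \<and> spanning (with_proj T) (with_proj G)"

text \<open>
  A disconnected spanning subgraph of a connected graph is never an additive
  spanner, because some of its distances are infinite.
\<close>

definition additive_spanner :: "real \<Rightarrow> 'a pair_pre_digraph \<Rightarrow> 'a pair_pre_digraph \<Rightarrow> bool" where
  "additive_spanner c T G \<longleftrightarrow> spanning_subgraph T G \<and>
     (\<forall>u \<in> pverts G. \<forall>v \<in> pverts G. gdist T u v \<le> gdist G u v + ereal c)"

section \<open>k-trees\<close>

definition clique :: "nat \<Rightarrow> 'a set \<Rightarrow> 'a pair_pre_digraph \<Rightarrow> bool" where
  "clique n K G \<longleftrightarrow> K \<subseteq> pverts G \<and> complete_digraph n (with_proj G \<restriction> K)"

inductive k_tree :: "nat \<Rightarrow> 'a pair_pre_digraph \<Rightarrow> bool" for k :: nat where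
  base: "complete_digraph (k + 1) (with_proj G) \<Longrightarrow> k_tree k G"
| step: "\<lbrakk> k_tree k G; clique k K G; z \<notin> pverts G \<rbrakk> \<Longrightarrow>
    k_tree k \<lparr> pverts = insert z (pverts G),
               parcs = parcs G \<union> {z} \<times> K \<union> K \<times> {z} \<rparr>"

section \<open>Treewidth\<close>

text \<open>
  The predicate \<^const>\<open>tree\<close> of the library does not describe undirected
  trees: it forbids all directed cycles, and the two arcs of an undirected edge
  form a directed cycle of length 2. In a \<^locale>\<open>pair_graph\<close>, the
  undirected cycles are the directed cycles of length at least 3.
\<close>

definition undirected_tree :: "'a pair_pre_digraph \<Rightarrow> bool" where
  "undirected_tree D \<longleftrightarrow> pair_graph D \<and> Digraph_Component.connected (with_proj D) \<and>
     \<not> (\<exists>p. pre_digraph.cycle (with_proj D) p \<and> length p \<ge> 3)"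

text \<open>
  The nodes of the decomposition tree \<open>D\<close> are natural numbers; this is no
  restriction, since the tree is finite. The last condition says that the
  nodes whose bags contain a given vertex induce a (nonempty) subtree.
\<close>

definition tree_decomposition ::
    "'a pair_pre_digraph \<Rightarrow> nat pair_pre_digraph \<Rightarrow> (nat \<Rightarrow> 'a set) \<Rightarrow> bool" where
  "tree_decomposition G D bag \<longleftrightarrow> undirected_tree D \<and>
     (\<Union>i \<in> pverts D. bag i) = pverts G \<and>
     (\<forall>(u, v) \<in> parcs G. \<exists>i \<in> pverts D. u \<in> bag i \<and> v \<in> bag i) \<and>
     (\<forall>v \<in> pverts G. Digraph_Component.connected (with_proj D \<restriction> {i \<in> pverts D. v \<in> bag i}))"

definition decomposition_width :: "nat pair_pre_digraph \<Rightarrow> (nat \<Rightarrow> 'a set) \<Rightarrow> nat" where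
  "decomposition_width D bag = Max ((\<lambda>i. card (bag i)) ` pverts D) - 1"

text \<open>
  The truncated subtraction above matters only for the null graph, whose
  treewidth is 0 here; a decomposition of any other graph has a nonempty bag.
\<close>

definition treewidth :: "'a pair_pre_digraph \<Rightarrow> nat" where
  "treewidth G = (LEAST w. \<exists>D bag. tree_decomposition G D bag \<and> decomposition_width D bag = w)"

end

theory Submission
  imports Defs
begin

text \<open>
  In a sufficiently deep \<open>k\<close>-tree, follow a sequence of \<open>k\<close>-cliques in which each clique \<open>K\<close>
  arises from the previous one by exchanging one vertex for a new vertex \<open>z\<close>, adjacent to all of
  it. Behind every clique there are \<open>k\<close> disjoint copies of the rest of the construction. A subgraph
  \<open>T\<close> of treewidth below \<open>k\<close> has no \<open>K\<^bsub>k,k\<^esub>\<close> minor, so in one of the copies the part of \<open>T\<close>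
  behind \<open>K\<close> fails to connect \<open>z\<close> with all of \<open>K\<close>, and the connections in \<open>T\<close> from \<open>z\<close> to
  the missed vertices must return through \<open>K\<close>. With a suitable choice of the exchanged vertex, either
  fewer pairs of the clique are linked behind it, or the distances in \<open>T\<close> across unlinked pairs
  grow. Since adjacent vertices of \<open>G\<close> have bounded distance in an additive spanner, this cannot go
  on for ever.
\<close>

section \<open>Connected vertex sets\<close>

text \<open>Phrased by cuts instead of walks, since the proofs below mostly need an arc leaving a
  proper nonempty subset. Branch sets and subtrees must be nonempty, hence the first
  conjunct.\<close>

definition connected_in :: "'a rel \<Rightarrow> 'a set \<Rightarrow> bool" where
  "connected_in R X \<longleftrightarrow> X \<noteq> {} \<and>
     (\<forall>Y \<subseteq> X. Y \<noteq> {} \<longrightarrow> Y \<noteq> X \<longrightarrow> (\<exists>y \<in> Y. \<exists>x \<in> X - Y. (y, x) \<in> R))"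

lemma connected_in_cut:
  "connected_in R X \<Longrightarrow> Y \<subseteq> X \<Longrightarrow> Y \<noteq> {} \<Longrightarrow> Y \<noteq> X \<Longrightarrow> \<exists>y \<in> Y. \<exists>x \<in> X - Y. (y, x) \<in> R"
  unfolding connected_in_def by simp

lemma connected_in_nonempty: "connected_in R X \<Longrightarrow> X \<noteq> {}"
  unfolding connected_in_def by simp

lemma connected_in_singleton: "connected_in R {a}"
  unfolding connected_in_def by blast

lemma connected_in_insert:
  assumes "sym R" "connected_in R X" "x \<in> X" "(a, x) \<in> R"
  shows "connected_in R (insert a X)"
  unfolding connected_in_def
proof (intro conjI allI impI)
  fix Y assume Y: "Y \<subseteq> insert a X" "Y \<noteq> {}" "Y \<noteq> insert a X"
  show "\<exists>y\<in>Y. \<exists>z\<in>insert a X - Y. (y, z) \<in> R"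
  proof (cases "Y \<inter> X = {} \<or> Y \<inter> X = X")
    case True
    then show ?thesis using Y assms(3,4) symD[OF assms(1,4)] by blast
  next
    case False
    then have "\<exists>y\<in>Y \<inter> X. \<exists>z\<in>X - Y \<inter> X. (y, z) \<in> R"
      using assms(2) by (intro connected_in_cut) auto
    then show ?thesis by blast
  qed
qed simp

text \<open>Given a cut \<open>Y\<close> of \<open>X - {v}\<close>, put \<open>v\<close> on the side
  of \<open>Y\<close> if \<open>Y\<close> contains a neighbour of \<open>v\<close>, and on the other
  side otherwise. Either way the crossing arc avoids \<open>v\<close>.\<close>

lemma connected_in_remove:
  assumes R: "sym R" and X: "connected_in R X" "X \<noteq> {v}"
    and leaf: "\<And>p q. p \<in> X - {v} \<Longrightarrow> q \<in> X - {v} \<Longrightarrow> (v, p) \<in> R \<Longrightarrow> (v, q) \<in> R \<Longrightarrow> p = q"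
  shows "connected_in R (X - {v})"
proof (cases "v \<in> X")
  case False
  then show ?thesis using X by simp
next
  case v: True
  have cut: "\<exists>y\<in>Y. \<exists>x\<in>X - Y. (y, x) \<in> R" if "Y \<subseteq> X" "Y \<noteq> {}" "Y \<noteq> X" for Y
    using X(1) that by (rule connected_in_cut)
  show ?thesis unfolding connected_in_def
  proof (intro conjI allI impI)
    show "X - {v} \<noteq> {}" using v X(2) by blast
    fix Y assume Y: "Y \<subseteq> X - {v}" "Y \<noteq> {}" "Y \<noteq> X - {v}"
    show "\<exists>y\<in>Y. \<exists>x\<in>X - {v} - Y. (y, x) \<in> R"
    proof (cases "\<exists>p \<in> Y. (v, p) \<in> R")
      case True
      then obtain p where p: "p \<in> Y" "(v, p) \<in> R" by blast
      obtain y x where yx: "y \<in> insert v Y" "x \<in> X - insert v Y" "(y, x) \<in> R"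
        using cut[of "insert v Y"] Y v by blast
      have "y \<noteq> v"
      proof
        assume "y = v"
        then have "x = p" using leaf[of x p] yx p Y by blast
        then show False using p yx by blast
      qed
      then show ?thesis using yx by blast
    next
      case False
      obtain y x where yx: "y \<in> Y" "x \<in> X - Y" "(y, x) \<in> R" using cut[of Y] Y v by blast
      moreover have "x \<noteq> v" using False yx R by (auto dest: symD)
      ultimately show ?thesis by blast
    qed
  qed
qed

text \<open>The library speaks of reachability in the symmetrised induced subgraph. As
  \<open>parcs D\<close> is symmetric, this uses only arcs of \<open>D\<close>, and a walk cannot
  leave \<open>Y\<close> without an arc that does.\<close>

lemma connected_in_imp_induced:
  assumes R: "sym (parcs D)" and conn: "Digraph_Component.connected (with_proj D \<restriction> X)"
  shows "connected_in (parcs D) X"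
proof -
  let ?M = "mk_symmetric (with_proj D \<restriction> X)"
  have M: "parcs ?M \<subseteq> parcs D \<inter> X \<times> X"
    using R by (auto simp: parcs_mk_symmetric induce_subgraph_def dest: symD)
  have sc: "X \<noteq> {}" "\<And>u v. u \<in> X \<Longrightarrow> v \<in> X \<Longrightarrow> (u, v) \<in> rtrancl_on X (parcs ?M)"
    using conn unfolding Digraph_Component.connected_def strongly_connected_def reachable_def by auto
  show ?thesis unfolding connected_in_def
  proof (intro conjI allI impI)
    show "X \<noteq> {}" by fact
    fix Y assume Y: "Y \<subseteq> X" "Y \<noteq> {}" "Y \<noteq> X"
    then obtain y x where "y \<in> Y" "x \<in> X - Y" by blast
    show "\<exists>y\<in>Y. \<exists>x\<in>X - Y. (y, x) \<in> parcs D"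
    proof (rule ccontr)
      assume no: "\<not> ?thesis"
      have "(y, x) \<in> rtrancl_on X (parcs ?M)" using sc \<open>y \<in> Y\<close> \<open>x \<in> X - Y\<close> Y by blast
      then have "x \<in> Y"
        by (induction rule: rtrancl_on_induct) (use \<open>y \<in> Y\<close> M no in blast)+
      then show False using \<open>x \<in> X - Y\<close> by blast
    qed
  qed
qed

section \<open>Components inside a vertex set\<close>

definition component :: "'a rel \<Rightarrow> 'a set \<Rightarrow> 'a \<Rightarrow> 'a set" where
  "component R B z = {x. (z, x) \<in> (R \<inter> B \<times> B)\<^sup>*}"

lemma component_refl: "z \<in> component R B z"
  by (simp add: component_def)

lemma component_subset: "z \<in> B \<Longrightarrow> component R B z \<subseteq> B"
  unfolding component_def by (auto elim: rtranclE)

lemma component_step: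
  "c \<in> component R B z \<Longrightarrow> c \<in> B \<Longrightarrow> (c, x) \<in> R \<Longrightarrow> x \<in> B \<Longrightarrow> x \<in> component R B z"
  unfolding component_def by (auto intro: rtrancl_into_rtrancl)

text \<open>If no arc left \<open>Y\<close>, then by symmetry none would enter it from the
  component, and membership in \<open>Y\<close> would be constant along walks from
  \<open>z\<close>.\<close>

lemma connected_in_component:
  assumes "sym R" "z \<in> B"
  shows "connected_in R (component R B z)"
  unfolding connected_in_def
proof (intro conjI allI impI)
  show "component R B z \<noteq> {}" by (auto simp: component_def)
  fix Y assume Y: "Y \<subseteq> component R B z" "Y \<noteq> {}" "Y \<noteq> component R B z"
  show "\<exists>y\<in>Y. \<exists>x\<in>component R B z - Y. (y, x) \<in> R"
  proof (rule ccontr)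
    assume no: "\<not> ?thesis"
    have sub: "component R B z \<subseteq> B" using assms(2) by (rule component_subset)
    have fwd: "(z, x) \<in> (R \<inter> B \<times> B)\<^sup>* \<Longrightarrow> (z \<in> Y \<longleftrightarrow> x \<in> Y)" for x
    proof (induction rule: rtrancl_induct)
      case base
      show ?case ..
    next
      case (step x y)
      then have "x \<in> component R B z" "y \<in> component R B z"
        by (auto simp: component_def intro: rtrancl_into_rtrancl)
      moreover have "(x, y) \<in> R" "(y, x) \<in> R" using step.hyps(2) assms(1) by (auto dest: symD)
      ultimately show ?case using no step.IH by blast
    qed
    then have "x \<in> Y \<longleftrightarrow> y \<in> Y" if "x \<in> component R B z" "y \<in> component R B z" for x y
      using that unfolding component_def by blast
    then show False using Y by blast
  qed
qed

section \<open>Descent through nested pockets\<close>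

text \<open>
  A pocket \<open>P a\<close> is a set of vertices that \<open>K\<close> separates from the rest of the graph; its apex
  \<open>z\<close> is adjacent to all of \<open>K\<close>, and exchanging any \<open>l \<in> K\<close> for \<open>z\<close> gives a set with
  pockets of its own, inside \<open>P a\<close>. There are as many pockets as elements of \<open>K\<close>, so if each of
  them connected its apex to all of \<open>K\<close>, they would form a \<open>K\<^bsub>k,k\<^esub>\<close> minor.
\<close>

primrec deep :: "'a rel \<Rightarrow> nat \<Rightarrow> 'a set \<Rightarrow> 'a set \<Rightarrow> bool" where
  "deep E 0 K B \<longleftrightarrow> True"
| "deep E (Suc n) K B \<longleftrightarrow> (\<exists>P. disjoint_family_on P K \<and> (\<forall>a \<in> K.
     P a \<subseteq> B \<and> K \<inter> P a = {} \<and> E `` P a \<subseteq> P a \<union> K \<and>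
     (\<exists>z \<in> P a. {z} \<times> K \<subseteq> E \<and>
        (\<forall>l \<in> K. \<exists>B' \<subseteq> P a - {z}. deep E n (insert z (K - {l})) B'))))"

definition pocket :: "'a rel \<Rightarrow> nat \<Rightarrow> 'a set \<Rightarrow> 'a set \<Rightarrow> bool" where
  "pocket E n K Q \<longleftrightarrow> K \<inter> Q = {} \<and> E `` Q \<subseteq> Q \<union> K \<and>
     (\<exists>z \<in> Q. {z} \<times> K \<subseteq> E \<and>
        (\<forall>l \<in> K. \<exists>B' \<subseteq> Q - {z}. deep E n (insert z (K - {l})) B'))"

lemma deep_Suc:
  "deep E (Suc n) K B \<longleftrightarrow>
     (\<exists>P. disjoint_family_on P K \<and> (\<forall>a \<in> K. P a \<subseteq> B \<and> pocket E n K (P a)))"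
  by (simp add: pocket_def)

text \<open>These are the pairs joined by a walk whose interior is nonempty and lies in
  \<open>B\<close>; a direct arc between two vertices of \<open>K\<close> alone does not link
  them.\<close>

definition linked :: "'a rel \<Rightarrow> 'a set \<Rightarrow> 'a set \<Rightarrow> 'a rel" where
  "linked R K B = {(i, j). i \<in> K \<and> j \<in> K \<and> i \<noteq> j \<and>
     (\<exists>x \<in> B. \<exists>y \<in> component R B x. (i, x) \<in> R \<and> (y, j) \<in> R)}"

text \<open>The value is meaningful only if some walk exists, which \<open>potential_descent\<close>
  assumes for the pairs it compares.\<close>

definition rdist :: "'a rel \<Rightarrow> 'a \<Rightarrow> 'a \<Rightarrow> nat" where
  "rdist R u v = (LEAST n. (u, v) \<in> R ^^ n)"

lemma rdist_le: "(u, v) \<in> R ^^ n \<Longrightarrow> rdist R u v \<le> n"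
  unfolding rdist_def by (rule Least_le)

lemma relpow_rdist: "(u, v) \<in> R ^^ n \<Longrightarrow> (u, v) \<in> R ^^ rdist R u v"
  unfolding rdist_def by (rule LeastI)

lemma sym_relpow: "sym R \<Longrightarrow> sym (R ^^ n)"
proof (induction n)
  case (Suc n)
  then show ?case by (meson relpow_Suc_E relpow_Suc_I2 symD symI)
qed (auto simp: sym_def)

lemma rdist_commute: "sym R \<Longrightarrow> rdist R u v = rdist R v u"
  unfolding rdist_def by (metis sym_relpow symD)

lemma component_mono: "B \<subseteq> B' \<Longrightarrow> component R B x \<subseteq> component R B' x"
  unfolding component_def by (auto elim!: rtrancl_mono[THEN subsetD, rotated])

lemma component_trans:
  "x \<in> component R B z \<Longrightarrow> y \<in> component R B x \<Longrightarrow> y \<in> component R B z"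
  unfolding component_def by simp

lemma component_sym: "sym R \<Longrightarrow> x \<in> component R B z \<Longrightarrow> z \<in> component R B x"
proof -
  assume "sym R"
  then have "sym ((R \<inter> B \<times> B)\<^sup>*)" by (intro sym_rtrancl) (auto simp: sym_def)
  then show "x \<in> component R B z \<Longrightarrow> z \<in> component R B x"
    unfolding component_def by (auto dest: symD)
qed

lemma sym_linked: "sym R \<Longrightarrow> sym (linked R K B)"
proof (rule symI)
  fix i j assume R: "sym R" and "(i, j) \<in> linked R K B"
  then obtain x y where *: "i \<in> K" "j \<in> K" "i \<noteq> j" "x \<in> B" "y \<in> component R B x" "(i, x) \<in> R" "(y, j) \<in> R"
    unfolding linked_def by blast
  moreover have "y \<in> B" using * component_subset by fast
  moreover have "(j, y) \<in> R" "(x, i) \<in> R" "x \<in> component R B y"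
    using * R by (auto dest: symD intro: component_sym)
  ultimately show "(j, i) \<in> linked R K B" unfolding linked_def by blast
qed

text \<open>
  The cap \<open>L\<close> only gives a value to vertices that are linked to all others.
\<close>

definition gap :: "'a rel \<Rightarrow> nat \<Rightarrow> 'a set \<Rightarrow> 'a set \<Rightarrow> 'a \<Rightarrow> nat" where
  "gap R L K B s = Min (insert L (rdist R s ` {i \<in> K - {s}. (s, i) \<notin> linked R K B}))"

text \<open>
  Lexicographic: the factor exceeds every value of the second summand, so a drop in the number of
  links outweighs any change of the gaps.
\<close>

definition potential :: "'a rel \<Rightarrow> nat \<Rightarrow> 'a set \<Rightarrow> 'a set \<Rightarrow> nat" where
  "potential R L K B = card (linked R K B) * (card K * L + 1) +
     (card K * L - (\<Sum>s\<in>K. gap R L K B s))"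

lemma gap_le: "finite K \<Longrightarrow> gap R L K B s \<le> L"
  unfolding gap_def by simp

lemma gap_le_rdist:
  "finite K \<Longrightarrow> i \<in> K \<Longrightarrow> i \<noteq> s \<Longrightarrow> (s, i) \<notin> linked R K B \<Longrightarrow> gap R L K B s \<le> rdist R s i"
  unfolding gap_def by (intro Min_le) auto

lemma le_gap:
  assumes "finite K" "m \<le> L"
    and "\<And>i. i \<in> K \<Longrightarrow> i \<noteq> s \<Longrightarrow> (s, i) \<notin> linked R K B \<Longrightarrow> m \<le> rdist R s i"
  shows "m \<le> gap R L K B s"
  unfolding gap_def using assms by (intro Min.boundedI) auto

lemma finite_linked: "finite K \<Longrightarrow> finite (linked R K B)"
  by (rule finite_subset[of _ "K \<times> K"]) (auto simp: linked_def)

text \<open>Take the first vertex of the walk outside the component. Its predecessor lies in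
  \<open>P\<close>, so it cannot lie in \<open>P\<close> itself and must belong to \<open>K\<close>;
  the rest of the walk is strictly shorter.\<close>

lemma exit_component:
  assumes closed: "R `` P \<subseteq> P \<union> K" and z: "z \<in> P"
    and "(c, i) \<in> R ^^ m" "c \<in> component R P z" "i \<notin> component R P z"
  shows "\<exists>s \<in> K. \<exists>c' \<in> component R P z. (c', s) \<in> R \<and> (\<exists>m'<m. (s, i) \<in> R ^^ m')"
  using assms(3-5)
proof (induction m arbitrary: c)
  case 0
  then show ?case by simp
next
  case (Suc m)
  from Suc.prems(1) obtain y where y: "(c, y) \<in> R" "(y, i) \<in> R ^^ m"
    by (meson relpow_Suc_D2)
  show ?case
  proof (cases "y \<in> component R P z")
    case True
    from Suc.IH[OF y(2) True Suc.prems(3)] show ?thesis by (meson less_Suc_eq)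
  next
    case False
    have "c \<in> P" using Suc.prems(2) component_subset[OF z] by blast
    then have "y \<notin> P" using component_step[OF Suc.prems(2) _ y(1)] False by blast
    then have "y \<in> K" using \<open>c \<in> P\<close> y(1) closed by blast
    then show ?thesis using y Suc.prems(2) by blast
  qed
qed

text \<open>
  Let \<open>S \<subset> K\<close> be the vertices reached by the component of the apex \<open>z\<close> in its pocket.
  A new link of \<open>z\<close> goes to \<open>S\<close>, and \<open>S\<close> is a clique of links, so renaming \<open>z\<close> to \<open>l \<in> S\<close>
  embeds the new links into the old ones. If no choice of \<open>l\<close> loses a link, then the vertices of
  \<open>S\<close> have no links outside \<open>S\<close>. A walk from \<open>z\<close> to \<open>K - S\<close> passes through \<open>S\<close>, so \<open>z\<close> has
  a larger gap than the vertex \<open>l\<close> of smallest gap in \<open>S\<close>, and no other gap decreases.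
\<close>

lemma potential_descent:
  fixes R :: "'a rel"
  assumes R: "sym R" and K: "finite K" "z \<notin> K" "K \<inter> P = {}"
    and P: "P \<subseteq> B" "R `` P \<subseteq> P \<union> K" "z \<in> P"
    and B': "\<And>l. l \<in> K \<Longrightarrow> B' l \<subseteq> P - {z}"
    and L: "\<And>u v. u \<in> insert z K \<Longrightarrow> v \<in> insert z K \<Longrightarrow> u \<noteq> v \<Longrightarrow> \<exists>n\<le>L. (u, v) \<in> R ^^ n"
    and j: "j \<in> K" "\<forall>c \<in> component R P z. (c, j) \<notin> R"
  shows "\<exists>l \<in> K. potential R L (insert z (K - {l})) (B' l) < potential R L K B"
proof -
  define C where "C = component R P z"
  define S where "S = {s \<in> K. \<exists>c \<in> C. (c, s) \<in> R}"
  define A where "A = linked R K B"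
  define A' where "A' l = linked R (insert z (K - {l})) (B' l)" for l
  have CP: "C \<subseteq> P" unfolding C_def by (rule component_subset) fact
  have zC: "z \<in> C" unfolding C_def by (rule component_refl)
  have finS: "finite S" and SK: "S \<subseteq> K" using K(1) unfolding S_def by auto
  have jS: "j \<in> K - S" using j unfolding S_def C_def by auto
  have rd: "(u, v) \<in> R ^^ rdist R u v \<and> rdist R u v \<le> L"
    if "u \<in> insert z K" "v \<in> insert z K" "u \<noteq> v" for u v
  proof -
    from L[OF that] obtain n where "n \<le> L" "(u, v) \<in> R ^^ n" by blast
    then show ?thesis using relpow_rdist rdist_le order_trans by metis
  qed
  have far: "\<exists>s \<in> S. rdist R s i < rdist R z i" if i: "i \<in> K - S" for i
  proof -
    have "(z, i) \<in> R ^^ rdist R z i" using rd[of z i] i K(2) by auto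
    moreover have "i \<notin> C" using i CP K(3) by blast
    ultimately obtain s c' m' where "s \<in> K" "c' \<in> C" "(c', s) \<in> R" "m' < rdist R z i" "(s, i) \<in> R ^^ m'"
      using exit_component[OF P(2,3)] zC unfolding C_def by metis
    then show ?thesis unfolding S_def using rdist_le[of s i m' R] by force
  qed
  have Sne: "S \<noteq> {}" using far[OF jS] by blast
  have SA: "(s, t) \<in> A" if st: "s \<in> S" "t \<in> S" "s \<noteq> t" for s t
  proof -
    from st obtain c d where cd: "c \<in> C" "d \<in> C" "(c, s) \<in> R" "(d, t) \<in> R" unfolding S_def by blast
    have "d \<in> component R P c" using cd(1,2) R unfolding C_def by (meson component_sym component_trans)
    then have "d \<in> component R B c" using component_mono[OF P(1)] by blast
    moreover have "c \<in> B" "(s, c) \<in> R" using cd CP P(1) R by (auto dest: symD)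
    ultimately show ?thesis using st SK cd(4) unfolding A_def linked_def by blast
  qed
  have symA: "sym A" and symA': "sym (A' l)" for l unfolding A_def A'_def using R by (auto intro: sym_linked)
  have A'A: "(s, t) \<in> A" if "(s, t) \<in> A' l" "s \<noteq> z" "t \<noteq> z" "l \<in> K" for s t l
  proof -
    have "B' l \<subseteq> B" using B'[OF that(4)] P(1) by blast
    then show ?thesis using that component_mono[of "B' l" B R] unfolding A_def A'_def linked_def by blast
  qed
  \<comment> \<open>A neighbour of \<open>z\<close> in \<open>B' l\<close> lies in \<open>P\<close>,
    hence in \<open>C\<close>, and so does the component of \<open>B' l\<close> through which the
    link runs.\<close>
  have A'z: "t \<in> S - {l}" if zt: "(z, t) \<in> A' l" "l \<in> K" for t l
  proof -
    obtain x y where xy: "t \<in> K - {l}" "x \<in> B' l" "y \<in> component R (B' l) x" "(z, x) \<in> R" "(y, t) \<in> R"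
      using zt unfolding A'_def linked_def by blast
    have "x \<in> P" using xy B' zt by blast
    then have "x \<in> C" using component_step[of z R P z x] xy(4) P(3) zC unfolding C_def by blast
    moreover have "y \<in> component R P x" using component_mono[of "B' l" P R x] B'[OF zt(2)] xy(3) by blast
    ultimately have "y \<in> C" unfolding C_def by (meson component_trans)
    then show ?thesis using xy unfolding S_def by blast
  qed
  \<comment> \<open>Renames \<open>z\<close> to \<open>l\<close> at both ends of a pair. This is
    injective on the new links because \<open>l\<close> has left the clique.\<close>
  define f where "f l = map_prod (id(z := l)) (id(z := l))" for l :: 'a
  have inj: "inj_on (f l) (A' l)" if "l \<in> K" for l
  proof (rule inj_on_subset)
    have "inj_on (id(z := l)) (insert z (K - {l}))" by (auto simp: inj_on_def)
    then show "inj_on (f l) (insert z (K - {l}) \<times> insert z (K - {l}))"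
      unfolding f_def by (intro map_prod_inj_on)
    show "A' l \<subseteq> insert z (K - {l}) \<times> insert z (K - {l})" unfolding A'_def linked_def by auto
  qed
  have im: "f l ` A' l \<subseteq> A" if l: "l \<in> S" for l
  proof -
    have lK: "l \<in> K" using l SK by blast
    have "f l (s, t) \<in> A" if st: "(s, t) \<in> A' l" for s t
    proof -
      have ne: "s \<noteq> t" using st unfolding A'_def linked_def by blast
      have ts: "(t, s) \<in> A' l" using st symA' by (blast dest: symD)
      consider "s = z" "t \<noteq> z" | "t = z" "s \<noteq> z" | "s \<noteq> z" "t \<noteq> z" using ne by blast
      then show ?thesis
      proof cases
        case 1
        then show ?thesis using A'z[of t l] st lK SA[of l t] l by (auto simp: f_def)
      next
        case 2
        then show ?thesis using A'z[of s l] ts lK SA[of s l] l by (auto simp: f_def)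
      next
        case 3
        then show ?thesis using A'A st lK by (auto simp: f_def)
      qed
    qed
    then show ?thesis by auto
  qed
  have finA: "finite A" unfolding A_def using K(1) by (rule finite_linked)
  have cardK': "card (insert z (K - {l})) = card K" if "l \<in> K" for l
    using that K by (metis DiffD1 card_Suc_Diff1 card_insert_disjoint finite_Diff)
  let ?L = "card K * L"
  have sum_le: "(\<Sum>s\<in>K. gap R L K B s) \<le> ?L"
    using sum_bounded_above[of K "gap R L K B" L] gap_le[OF K(1)] by auto
  show ?thesis
  proof (cases "\<exists>l \<in> S. card (A' l) < card A")
    case True
    then obtain l where l: "l \<in> S" "Suc (card (A' l)) \<le> card A" by auto
    have "potential R L (insert z (K - {l})) (B' l) \<le> card (A' l) * (?L + 1) + ?L"
      unfolding potential_def using cardK'[of l] l SK by (simp add: A'_def subset_iff)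
    also have "\<dots> < Suc (card (A' l)) * (?L + 1)" by simp
    also have "\<dots> \<le> card A * (?L + 1)" using l(2) by (rule mult_le_mono1)
    also have "\<dots> \<le> potential R L K B" unfolding potential_def A_def by simp
    finally show ?thesis using l SK by blast
  next
    case False
    have eq: "f l ` A' l = A" and card_eq: "card (A' l) = card A" if l: "l \<in> S" for l
    proof -
      have lK: "l \<in> K" using l SK by blast
      have "card (A' l) = card (f l ` A' l)" using inj[OF lK] by (simp add: card_image)
      moreover have "card (f l ` A' l) \<le> card A" using im[OF l] finA by (intro card_mono)
      moreover have "\<not> card (A' l) < card A" using False l by blast
      ultimately show "card (A' l) = card A" "f l ` A' l = A"
        using card_subset_eq[OF finA im[OF l]] by auto
    qed
    \<comment> \<open>The preimage of \<open>(l, t)\<close> under \<open>f l\<close> is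
      \<open>(z, t)\<close>, since \<open>l\<close> is not in the new clique, and the new links of
      \<open>z\<close> end in \<open>S\<close>.\<close>
    have nbr: "t \<in> S" if "(l, t) \<in> A" "l \<in> S" for l t
    proof -
      from that eq obtain s' t' where st: "(s', t') \<in> A' l" "f l (s', t') = (l, t)"
        by (metis (no_types, lifting) imageE surj_pair)
      have s': "s' \<in> insert z (K - {l})" and ne: "s' \<noteq> t'" using st(1) unfolding A'_def linked_def by blast+
      then have "s' = z" "t' = t" using st(2) by (auto simp: f_def split: if_splits)
      then show ?thesis using A'z st(1) that SK by blast
    qed
    obtain l where l: "l \<in> S" and lmin: "\<And>s. s \<in> S \<Longrightarrow> gap R L K B l \<le> gap R L K B s"
      using arg_min_if_finite[OF finS Sne, of "gap R L K B"] by (metis not_le)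
    have lK: "l \<in> K" using l SK by blast
    define K' where "K' = insert z (K - {l})"
    have finK': "finite K'" using K unfolding K'_def by simp
    have AA': "(s, t) \<in> A' l" if "(s, t) \<in> A" "s \<in> K - {l}" "t \<in> K - {l}" for s t
    proof -
      from that(1) eq[OF l] obtain s' t' where st: "(s', t') \<in> A' l" "f l (s', t') = (s, t)"
        by (metis (no_types, lifting) imageE surj_pair)
      then have "s' = s" "t' = t" using that by (auto simp: f_def split: if_splits)
      then show ?thesis using st by simp
    qed
    have Az: "(z, t) \<in> A' l" if "t \<in> S" "t \<noteq> l" for t
    proof -
      have "(l, t) \<in> A" using SA l that by blast
      then obtain s' t' where st: "(s', t') \<in> A' l" "f l (s', t') = (l, t)"
        using eq[OF l] by (metis (no_types, lifting) imageE surj_pair)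
      have "s' \<in> insert z (K - {l})" using st(1) unfolding A'_def linked_def by blast
      then have "s' = z" "t' = t" using st(2) that by (auto simp: f_def split: if_splits)
      then show ?thesis using st by simp
    qed
    have outside: "gap R L K B s \<le> rdist R s i" if "s \<in> S" "i \<in> K - S" for s i
      using that SK nbr K(1) by (intro gap_le_rdist) (auto simp: A_def)
    have gz: "Suc (gap R L K B l) \<le> gap R L K' (B' l) z"
    proof (rule le_gap)
      have step: "Suc (gap R L K B l) \<le> rdist R z i" if i: "i \<in> K - S" for i
        using far[OF i] outside[OF _ i] lmin by (meson Suc_le_eq le_less_trans order_trans)
      \<comment> \<open>The vertex \<open>j\<close> is at distance at most \<open>L\<close> from
        \<open>z\<close>, so the gap of \<open>l\<close> lies strictly below the cap and has room to
        grow.\<close>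
      show "Suc (gap R L K B l) \<le> L" using step[OF jS] rd[of z j] jS K(2) by fastforce
      fix i assume "i \<in> K'" "i \<noteq> z" "(z, i) \<notin> linked R K' (B' l)"
      then have "i \<in> K - S" using Az[of i] unfolding A'_def K'_def by blast
      then show "Suc (gap R L K B l) \<le> rdist R z i" by (rule step)
    qed fact
    have gs: "gap R L K B s \<le> gap R L K' (B' l) s" if s: "s \<in> K - {l}" for s
    proof (rule le_gap)
      show "gap R L K B s \<le> L" using K(1) by (rule gap_le)
      fix i assume i: "i \<in> K'" "i \<noteq> s" "(s, i) \<notin> linked R K' (B' l)"
      show "gap R L K B s \<le> rdist R s i"
      proof (cases "i = z")
        case True
        \<comment> \<open>All of \<open>S - {l}\<close> is linked to \<open>z\<close>, so
          \<open>s\<close> lies outside \<open>S\<close>. Then some \<open>t\<close> in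
          \<open>S\<close> is closer to \<open>s\<close> than \<open>z\<close> is, and since
          \<open>s\<close> and \<open>t\<close> are not linked in \<open>A\<close>, the old gap of
          \<open>s\<close> is below its distance to \<open>z\<close>.\<close>
        have "s \<notin> S"
        proof
          assume "s \<in> S"
          then have "(s, z) \<in> A' l" using Az s symA' by (blast dest: symD)
          then show False using i True unfolding A'_def K'_def by simp
        qed
        then have sKS: "s \<in> K - S" using s by blast
        then obtain t where t: "t \<in> S" "rdist R t s < rdist R z s" using far by blast
        have "(s, t) \<notin> A" using nbr[of t s] t sKS symA by (blast dest: symD)
        then have "gap R L K B s \<le> rdist R s t"
          using t SK sKS K(1) by (intro gap_le_rdist) (auto simp: A_def)
        also have "\<dots> \<le> rdist R s z" using t(2) rdist_commute[OF R, of s] by simp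
        finally show ?thesis using True by simp
      next
        case False
        then have "i \<in> K - {l}" using i(1) unfolding K'_def by blast
        moreover from this have "(s, i) \<notin> A" using AA' s i(3) unfolding A'_def K'_def by blast
        ultimately show ?thesis using i K(1) by (intro gap_le_rdist) (auto simp: A_def)
      qed
    qed fact
    have "(\<Sum>s\<in>K. gap R L K B s) = gap R L K B l + (\<Sum>s\<in>K - {l}. gap R L K B s)"
      using K(1) lK by (rule sum.remove)
    also have "\<dots> < gap R L K' (B' l) z + (\<Sum>s\<in>K - {l}. gap R L K' (B' l) s)"
      using gz gs by (intro add_less_le_mono sum_mono) auto
    also have "\<dots> = (\<Sum>s\<in>K'. gap R L K' (B' l) s)" unfolding K'_def using K by simp
    finally have less: "(\<Sum>s\<in>K. gap R L K B s) < (\<Sum>s\<in>K'. gap R L K' (B' l) s)" .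
    have "(\<Sum>s\<in>K'. gap R L K' (B' l) s) \<le> ?L"
      using sum_bounded_above[of K' "gap R L K' (B' l)" L] gap_le[OF finK'] cardK'[OF lK] unfolding K'_def by auto
    then have "potential R L K' (B' l) < potential R L K B"
      unfolding potential_def using less cardK'[OF lK] card_eq[OF l] unfolding K'_def A_def A'_def by simp
    then show ?thesis using lK unfolding K'_def by blast
  qed
qed

text \<open>Each level of \<open>deep\<close> permits one descent of the potential, which therefore
  cannot start below the depth. \<open>no_minor\<close> excludes a complete bipartite minor with one
  side made of single vertices, and \<open>stretch\<close> provides the distance bound for the
  descent.\<close>

lemma deep_contradiction:
  fixes R E :: "'a rel"
  assumes R: "sym R" "R \<subseteq> E" and E: "sym E"
    and stretch: "\<And>u v. (u, v) \<in> E \<Longrightarrow> \<exists>n\<le>L. (u, v) \<in> R ^^ n"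
    and no_minor: "\<And>K C. card K = k \<Longrightarrow> disjoint_family_on C K \<Longrightarrow>
       (\<And>a. a \<in> K \<Longrightarrow> connected_in R (C a)) \<Longrightarrow> (\<And>a. a \<in> K \<Longrightarrow> K \<inter> C a = {}) \<Longrightarrow>
       (\<And>a s. a \<in> K \<Longrightarrow> s \<in> K \<Longrightarrow> \<exists>c \<in> C a. (c, s) \<in> R) \<Longrightarrow> False"
    and k: "k > 0"
    and "deep E n K B" "card K = k" "\<And>u v. u \<in> K \<Longrightarrow> v \<in> K \<Longrightarrow> u \<noteq> v \<Longrightarrow> (u, v) \<in> E"
    and "potential R L K B < n"
  shows False
  using assms(7-10)
proof (induction n arbitrary: K B)
  case 0
  then show ?case by simp
next
  case (Suc n)
  have finK: "finite K" using Suc.prems(2) k by (simp add: card_ge_0_finite)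
  from Suc.prems(1) obtain P where disj: "disjoint_family_on P K"
    and P: "\<forall>a \<in> K. P a \<subseteq> B \<and> K \<inter> P a = {} \<and> E `` P a \<subseteq> P a \<union> K \<and>
     (\<exists>z \<in> P a. {z} \<times> K \<subseteq> E \<and>
        (\<forall>l \<in> K. \<exists>B' \<subseteq> P a - {z}. deep E n (insert z (K - {l})) B'))"
    by auto
  then obtain z where z: "\<And>a. a \<in> K \<Longrightarrow> z a \<in> P a \<and> {z a} \<times> K \<subseteq> E \<and>
      (\<forall>l \<in> K. \<exists>B' \<subseteq> P a - {z a}. deep E n (insert (z a) (K - {l})) B')"
    by metis
  \<comment> \<open>Otherwise the apex components would all reach every vertex of \<open>K\<close>
    and form the excluded minor, with \<open>K\<close> as the other side.\<close>
  obtain a j where a: "a \<in> K" and j: "j \<in> K" "\<forall>c \<in> component R (P a) (z a). (c, j) \<notin> R"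
  proof (rule ccontr)
    assume "\<not> thesis"
    with that have hit: "\<exists>c \<in> component R (P a) (z a). (c, s) \<in> R" if "a \<in> K" "s \<in> K" for a s
      using that by blast
    have sub: "component R (P a) (z a) \<subseteq> P a" if "a \<in> K" for a
      using z that by (intro component_subset) blast
    show False
    proof (rule no_minor[of K "\<lambda>a. component R (P a) (z a)"])
      show "card K = k" by fact
      show "disjoint_family_on (\<lambda>a. component R (P a) (z a)) K"
        using disj sub unfolding disjoint_family_on_def by blast
      show "connected_in R (component R (P a) (z a))" if "a \<in> K" for a
        using that R(1) z by (intro connected_in_component) auto
      show "K \<inter> component R (P a) (z a) = {}" if "a \<in> K" for a
        using that sub P by blast
      show "\<exists>c \<in> component R (P a) (z a). (c, s) \<in> R" if "a \<in> K" "s \<in> K" for a s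
        using that by (rule hit)
    qed
  qed
  from z[OF a] obtain B' where B': "\<And>l. l \<in> K \<Longrightarrow> B' l \<subseteq> P a - {z a} \<and> deep E n (insert (z a) (K - {l})) (B' l)"
    by metis
  have Pa: "P a \<subseteq> B" "K \<inter> P a = {}" "E `` P a \<subseteq> P a \<union> K" "z a \<in> P a"
    using P z[OF a] a by simp_all
  have Ra: "R `` P a \<subseteq> P a \<union> K" "z a \<notin> K"
    using Pa R(2) by blast+
  have E': "(u, v) \<in> E" if "u \<in> insert (z a) K" "v \<in> insert (z a) K" "u \<noteq> v" for u v
  proof -
    have "(z a, s) \<in> E" "(s, z a) \<in> E" if "s \<in> K" for s
      using z[OF a] that E by (auto dest: symD)
    then show ?thesis using that Suc.prems(3) by blast
  qed
  have "\<exists>l\<in>K. potential R L (insert (z a) (K - {l})) (B' l) < potential R L K B"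
    by (rule potential_descent[where P = "P a" and j = j])
       (use R finK Pa Ra B' E' stretch j in \<open>auto simp: Int_commute\<close>)
  then obtain l where l: "l \<in> K" "potential R L (insert (z a) (K - {l})) (B' l) < potential R L K B" by blast
  show ?case
  proof (rule Suc.IH)
    show "deep E n (insert (z a) (K - {l})) (B' l)" using B' l by blast
    show "card (insert (z a) (K - {l})) = k"
      using Suc.prems(2) finK l(1) Ra(2) by (metis DiffD1 card_Suc_Diff1 card_insert_disjoint finite_Diff)
    show "(u, v) \<in> E" if "u \<in> insert (z a) (K - {l})" "v \<in> insert (z a) (K - {l})" "u \<noteq> v" for u v
      using that E' by blast
    show "potential R L (insert (z a) (K - {l})) (B' l) < n" using l(2) Suc.prems(4) by simp
  qed
qed

section \<open>Treewidth and minors\<close>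

text \<open>For symmetric \<open>R\<close> and finite \<open>W\<close> this describes forests, loops
  aside. Unlike being a tree, it passes to subsets, as the induction in
  \<open>subtrees_helly\<close> requires.\<close>

definition leafy :: "'a rel \<Rightarrow> 'a set \<Rightarrow> bool" where
  "leafy R W \<longleftrightarrow> (\<forall>X \<subseteq> W. X \<noteq> {} \<longrightarrow> (\<exists>v \<in> X. \<forall>p \<in> X - {v}. \<forall>q \<in> X - {v}.
     (v, p) \<in> R \<longrightarrow> (v, q) \<in> R \<longrightarrow> p = q))"

lemma leafyD:
  "leafy R W \<Longrightarrow> X \<subseteq> W \<Longrightarrow> X \<noteq> {} \<Longrightarrow> \<exists>v \<in> X. \<forall>p \<in> X - {v}. \<forall>q \<in> X - {v}.
     (v, p) \<in> R \<longrightarrow> (v, q) \<in> R \<longrightarrow> p = q"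
  unfolding leafy_def by simp

lemma leafy_subset: "leafy R W \<Longrightarrow> W' \<subseteq> W \<Longrightarrow> leafy R W'"
  unfolding leafy_def by (meson order_trans)

text \<open>Peeling off a leaf keeps the subtrees connected and pairwise intersecting.\<close>

lemma subtrees_helly:
  assumes R: "sym R" and "finite W" "leafy R W" "I \<noteq> {}"
    and "\<And>i. i \<in> I \<Longrightarrow> X i \<subseteq> W \<and> connected_in R (X i)"
    and "\<And>i j. i \<in> I \<Longrightarrow> j \<in> I \<Longrightarrow> X i \<inter> X j \<noteq> {}"
  shows "\<exists>t. \<forall>i \<in> I. t \<in> X i"
  using assms(2-)
proof (induction arbitrary: X rule: finite_psubset_induct)
  case (psubset W)
  obtain i where "i \<in> I" using psubset.prems(2) by blast
  then have "X i \<subseteq> W" "X i \<noteq> {}"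
    using psubset.prems(3) connected_in_nonempty by blast+
  then have "W \<noteq> {}" by blast
  then obtain v where v: "v \<in> W"
    and leaf: "\<And>p q. p \<in> W - {v} \<Longrightarrow> q \<in> W - {v} \<Longrightarrow> (v, p) \<in> R \<Longrightarrow> (v, q) \<in> R \<Longrightarrow> p = q"
    using leafyD[OF psubset.prems(1) order_refl] by blast
  show ?case
  proof (cases "\<exists>i \<in> I. X i = {v}")
    case True
    then obtain i where "i \<in> I" "X i = {v}" by blast
    then have "v \<in> X j" if "j \<in> I" for j using psubset.prems(4)[of i j] that by simp
    then show ?thesis by blast
  next
    case False
    have nbr: "\<exists>p. p \<in> X i \<and> p \<noteq> v \<and> (v, p) \<in> R" if "i \<in> I" "v \<in> X i" for i
    proof -
      have "connected_in R (X i)" "X i \<noteq> {v}" using psubset.prems(3) that False by blast+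
      then have "\<exists>y\<in>{v}. \<exists>x\<in>X i - {v}. (y, x) \<in> R"
        using that(2) by (intro connected_in_cut) auto
      then show ?thesis by blast
    qed
    have "\<exists>t. \<forall>i \<in> I. t \<in> X i - {v}"
    proof (rule psubset.IH[of "W - {v}"])
      show "W - {v} \<subset> W" using v by blast
      show "leafy R (W - {v})" using psubset.prems(1) by (rule leafy_subset) blast
      show "I \<noteq> {}" by fact
      show "X i - {v} \<subseteq> W - {v} \<and> connected_in R (X i - {v})" if "i \<in> I" for i
      proof
        show "X i - {v} \<subseteq> W - {v}" using psubset.prems(3) that by blast
        show "connected_in R (X i - {v})"
          using R psubset.prems(3)[OF that] False that leaf by (intro connected_in_remove) blast+
      qed
      \<comment> \<open>A subtree through \<open>v\<close> is connected and larger than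
        \<open>{v}\<close>, so it contains the only neighbour of \<open>v\<close> in
        \<open>W\<close>; two such subtrees still meet there.\<close>
      show "(X i - {v}) \<inter> (X j - {v}) \<noteq> {}" if ij: "i \<in> I" "j \<in> I" for i j
      proof (cases "v \<in> X i \<and> v \<in> X j")
        case True
        obtain p where p: "p \<in> X i" "p \<noteq> v" "(v, p) \<in> R" using nbr[of i] ij True by blast
        obtain q where q: "q \<in> X j" "q \<noteq> v" "(v, q) \<in> R" using nbr[of j] ij True by blast
        have "X i \<subseteq> W" "X j \<subseteq> W" using psubset.prems(3) ij by simp_all
        then have "p = q" using p q by (intro leaf) auto
        then show ?thesis using p q by blast
      next
        case False
        then show ?thesis using psubset.prems(4)[OF ij] by blast
      qed
    qed
    then show ?thesis by blast
  qed
qed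

lemma cas_zip:
  "vs \<noteq> [] \<Longrightarrow> pcas (hd vs) (zip vs (tl vs)) (last vs)"
proof (induction vs rule: induct_list012)
qed auto

lemma pawalk_verts_zip:
  "vs \<noteq> [] \<Longrightarrow> pawalk_verts (hd vs) (zip vs (tl vs)) = vs"
proof (induction vs rule: induct_list012)
qed auto

text \<open>Suppose that every vertex of \<open>X\<close> has two neighbours in \<open>X\<close>.
  The neighbours in \<open>X\<close> of the first vertex of a longest path in \<open>X\<close> all
  lie on the path, and one of them other than the second vertex closes a cycle.\<close>

lemma undirected_tree_leafy:
  assumes D: "undirected_tree D"
  shows "leafy (parcs D) (pverts D)"
  unfolding leafy_def
proof (intro allI impI, rule ccontr)
  interpret pair_graph D using D unfolding undirected_tree_def by blast
  fix X assume X: "X \<subseteq> pverts D" "X \<noteq> {}"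
    and no: "\<not> (\<exists>v \<in> X. \<forall>p \<in> X - {v}. \<forall>q \<in> X - {v}.
     (v, p) \<in> parcs D \<longrightarrow> (v, q) \<in> parcs D \<longrightarrow> p = q)"
  have fin: "finite X" using X pair_finite_verts finite_subset by blast
  define path where "path vs \<longleftrightarrow> vs \<noteq> [] \<and> distinct vs \<and> set vs \<subseteq> X \<and> set (zip vs (tl vs)) \<subseteq> parcs D" for vs
  have bound: "length vs \<le> card X" if "path vs" for vs
    using that fin unfolding path_def by (metis card_mono distinct_card)
  obtain x where "x \<in> X" using X by blast
  then have "path [x]" unfolding path_def by simp
  then obtain vs where vs: "path vs" and max: "\<And>ws. path ws \<Longrightarrow> length ws \<le> length vs"
    using ex_has_greatest_nat[of path "[x]" length "Suc (card X)"] bound by (metis le_imp_less_Suc)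
  define v where "v = hd vs"
  have "v \<in> X" using vs unfolding path_def v_def by auto
  then obtain p q where pq: "p \<in> X" "q \<in> X" "(v, p) \<in> parcs D" "(v, q) \<in> parcs D" "p \<noteq> q" "p \<noteq> v" "q \<noteq> v"
    using no by blast
  have on: "w \<in> set vs" if w: "w \<in> X" "(v, w) \<in> parcs D" for w
  proof (rule ccontr)
    assume "w \<notin> set vs"
    moreover have "(w, v) \<in> parcs D" using w(2) by (rule arcs_symmetric)
    ultimately have "path (w # vs)" using vs w(1) unfolding path_def v_def by (cases vs) auto
    then show False using max by fastforce
  qed
  obtain w where w: "w \<in> set vs" "(v, w) \<in> parcs D" "w \<noteq> v" "w \<noteq> vs ! 1"
    using pq on by metis
  then obtain j where j: "j < length vs" "vs ! j = w" by (meson in_set_conv_nth)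
  have v0: "vs ! 0 = v" using vs unfolding path_def v_def by (simp add: hd_conv_nth)
  \<comment> \<open>Index 0 is \<open>v\<close> and index 1 is excluded by the choice of
    \<open>w\<close>. The closed walk below has \<open>j + 1\<close> arcs, hence at least 3.\<close>
  have j2: "j \<ge> 2" using j w v0 by (cases j; cases "j - 1") auto
  define us where "us = take (Suc j) vs"
  have us: "us \<noteq> []" "hd us = v" "last us = w" "distinct us" "length us = Suc j" "set us \<subseteq> X"
    using vs j unfolding us_def path_def v_def
    by (auto simp: last_conv_nth hd_conv_nth dest: in_set_takeD)
  have arcs_us: "set (zip us (tl us)) \<subseteq> parcs D"
  proof -
    have "zip us (tl us) = take j (zip vs (tl vs))"
      using j unfolding us_def by (intro nth_equalityI) (auto simp: nth_tl)
    then show ?thesis using vs set_take_subset[of j "zip vs (tl vs)"] unfolding path_def by auto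
  qed
  let ?p = "(w, v) # zip us (tl us)"
  have "awalk w ?p w"
    unfolding awalk_def using arcs_us us w X cas_zip[OF us(1)] arcs_symmetric[OF w(2)] last_in_set[OF us(1)]
    by auto
  moreover have "distinct (tl (pawalk_verts w ?p))"
    using pawalk_verts_zip[OF us(1)] us by simp
  ultimately have "pre_digraph.cycle (with_proj D) ?p"
    unfolding cycle_def by auto
  moreover have "length ?p \<ge> 3" using us j2 by simp
  ultimately show False using D unfolding undirected_tree_def by blast
qed

text \<open>The nodes whose bags meet a connected \<open>P i\<close> form a subtree, and the
  subtrees of two touching sets share a node. The Helly property then yields a node common to
  all.\<close>

lemma bag_meets_all:
  assumes T: "pair_graph T" and td: "tree_decomposition T D bag" and "I \<noteq> {}"
    and P: "\<And>i. i \<in> I \<Longrightarrow> P i \<subseteq> pverts T \<and> connected_in (parcs T) (P i)"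
    and touch: "\<And>i j. i \<in> I \<Longrightarrow> j \<in> I \<Longrightarrow> i \<noteq> j \<Longrightarrow> \<exists>u \<in> P i. \<exists>v \<in> P j. (u, v) \<in> parcs T"
  shows "\<exists>t \<in> pverts D. \<forall>i \<in> I. bag t \<inter> P i \<noteq> {}"
proof -
  interpret T: pair_graph T by fact
  have tree: "undirected_tree D"
    and edge: "\<And>u v. (u, v) \<in> parcs T \<Longrightarrow> \<exists>t \<in> pverts D. u \<in> bag t \<and> v \<in> bag t"
    and conn: "\<And>v. v \<in> pverts T \<Longrightarrow> Digraph_Component.connected (with_proj D \<restriction> {t \<in> pverts D. v \<in> bag t})"
    using td unfolding tree_decomposition_def by auto
  interpret D: pair_graph D using tree unfolding undirected_tree_def by blast
  have symD: "sym (parcs D)" by (auto intro: symI D.arcs_symmetric)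
  define N where "N v = {t \<in> pverts D. v \<in> bag t}" for v
  have N: "connected_in (parcs D) (N v)" if "v \<in> pverts T" for v
    unfolding N_def using symD conn[OF that] by (rule connected_in_imp_induced)
  define X where "X i = (\<Union>v \<in> P i. N v)" for i
  have "connected_in (parcs D) (X i)" if i: "i \<in> I" for i
    unfolding connected_in_def
  proof (intro conjI allI impI)
    have Pi: "P i \<noteq> {}" "P i \<subseteq> pverts T" using P[OF i] connected_in_nonempty by blast+
    have Nne: "N v \<noteq> {}" if "v \<in> P i" for v
      using N[of v] that Pi connected_in_nonempty by blast
    show "X i \<noteq> {}" unfolding X_def using Pi Nne by blast
    fix Y assume Y: "Y \<subseteq> X i" "Y \<noteq> {}" "Y \<noteq> X i"
    show "\<exists>y\<in>Y. \<exists>x\<in>X i - Y. (y, x) \<in> parcs D"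
    \<comment> \<open>Either the cut splits the subtree of a single vertex, or each
      \<open>N v\<close> lies on one side. In the latter case \<open>P i\<close> is cut as well, and
      a bag containing an edge of \<open>T\<close> across that cut gives a contradiction.\<close>
    proof (cases "\<exists>v \<in> P i. N v \<inter> Y \<noteq> {} \<and> N v - Y \<noteq> {}")
      case True
      then obtain v where v: "v \<in> P i" "N v \<inter> Y \<noteq> {}" "N v - Y \<noteq> {}" by blast
      then have "\<exists>y\<in>N v \<inter> Y. \<exists>x\<in>N v - N v \<inter> Y. (y, x) \<in> parcs D"
        using N[of v] Pi by (intro connected_in_cut) auto
      then show ?thesis using v(1) unfolding X_def by blast
    next
      case False
      define Q where "Q = {v \<in> P i. N v \<subseteq> Y}"
      have "Q \<noteq> {}"
      proof -
        obtain y v where "y \<in> Y" "v \<in> P i" "y \<in> N v" using Y unfolding X_def by blast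
        then show ?thesis using False unfolding Q_def by blast
      qed
      moreover have "Q \<noteq> P i" using Y unfolding Q_def X_def by blast
      moreover have "Q \<subseteq> P i" unfolding Q_def by blast
      ultimately obtain u v where uv: "u \<in> Q" "v \<in> P i - Q" "(u, v) \<in> parcs T"
        using connected_in_cut[of "parcs T" "P i" Q] P[OF i] by blast
      obtain t where "t \<in> N u" "t \<in> N v" using edge[OF uv(3)] unfolding N_def by blast
      then have False using uv False unfolding Q_def by blast
      then show ?thesis ..
    qed
  qed
  moreover have "X i \<subseteq> pverts D" for i unfolding X_def N_def by blast
  moreover have "X i \<inter> X j \<noteq> {}" if "i \<in> I" "j \<in> I" for i j
  proof (cases "i = j")
    case True
    then show ?thesis using connected_in_nonempty[OF calculation(1)[OF that(1)]] by simp
  next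
    case False
    with touch that obtain u v where "u \<in> P i" "v \<in> P j" "(u, v) \<in> parcs T" by blast
    then show ?thesis using edge[of u v] unfolding X_def N_def by blast
  qed
  ultimately obtain t where t: "\<forall>i \<in> I. t \<in> X i"
    using subtrees_helly[OF symD D.pair_finite_verts undirected_tree_leafy[OF tree] \<open>I \<noteq> {}\<close>, of X] by blast
  then show ?thesis using \<open>I \<noteq> {}\<close> unfolding X_def N_def by blast
qed

text \<open>The \<open>LEAST\<close> is attained because some decomposition exists: a single node
  whose bag is the whole vertex set.\<close>

lemma treewidth_decomposition:
  assumes T: "pair_graph T"
  shows "\<exists>D bag. tree_decomposition T D bag \<and> decomposition_width D bag = treewidth T"
  unfolding treewidth_def
proof (rule LeastI_ex)
  let ?D = "\<lparr>pverts = {0 :: nat}, parcs = {}\<rparr>"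
  have D: "pair_graph ?D" by unfold_locales (auto simp: symmetric_def)
  have conn: "Digraph_Component.connected (with_proj ?D \<restriction> {0})"
    unfolding Digraph_Component.connected_def strongly_connected_def reachable_def
    by auto
  have conn': "Digraph_Component.connected (with_proj ?D)"
    unfolding Digraph_Component.connected_def strongly_connected_def reachable_def
    by auto
  have acyclic: "\<not> pre_digraph.cycle (with_proj ?D) p" for p
    unfolding pre_digraph.cycle_def pre_digraph.awalk_def by (cases p) auto
  interpret pair_graph T by fact
  have "tree_decomposition T ?D (\<lambda>_. pverts T)"
    unfolding tree_decomposition_def undirected_tree_def
    using D conn conn' acyclic by (auto dest: wellformed')
  then show "\<exists>w D bag. tree_decomposition T D bag \<and> decomposition_width D bag = w" by blast
qed

text \<open>The \<open>P i\<close> are the branch sets of a complete minor on \<open>k + 1\<close>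
  vertices. Some bag meets all of them and, as they are disjoint, has at least \<open>k + 1\<close>
  elements.\<close>

lemma treewidth_ge_minor:
  assumes T: "pair_graph T" and I: "finite I" "card I = Suc k" "disjoint_family_on P I"
    and P: "\<And>i. i \<in> I \<Longrightarrow> P i \<subseteq> pverts T \<and> connected_in (parcs T) (P i)"
    and touch: "\<And>i j. i \<in> I \<Longrightarrow> j \<in> I \<Longrightarrow> i \<noteq> j \<Longrightarrow> \<exists>u \<in> P i. \<exists>v \<in> P j. (u, v) \<in> parcs T"
  shows "k \<le> treewidth T"
proof -
  obtain D bag where td: "tree_decomposition T D bag" and w: "decomposition_width D bag = treewidth T"
    using treewidth_decomposition[OF T] by blast
  have "I \<noteq> {}" using I(2) by auto
  from bag_meets_all[where P = P, OF T td this P touch]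
  obtain t where t: "t \<in> pverts D" "\<forall>i \<in> I. bag t \<inter> P i \<noteq> {}" by blast
  define g where "g i = (SOME x. x \<in> bag t \<inter> P i)" for i
  have g: "g i \<in> bag t \<inter> P i" if "i \<in> I" for i
    unfolding g_def using t(2) that by (intro some_in_eq[THEN iffD2]) blast
  have "inj_on g I"
  proof (rule inj_onI, rule ccontr)
    fix i j assume ij: "i \<in> I" "j \<in> I" "g i = g j" "i \<noteq> j"
    then have "P i \<inter> P j = {}" using I(3) unfolding disjoint_family_on_def by simp
    then show False using g[OF ij(1)] g[OF ij(2)] ij(3) by auto
  qed
  then have "Suc k = card (g ` I)" using I(2) by (simp add: card_image)
  moreover have "finite (pverts D)" "finite (bag t)"
  proof -
    interpret D: pair_graph D using td unfolding tree_decomposition_def undirected_tree_def by blast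
    interpret T: pair_graph T by fact
    show "finite (pverts D)" by (rule D.pair_finite_verts)
    have "bag t \<subseteq> pverts T" using td t(1) unfolding tree_decomposition_def by blast
    then show "finite (bag t)" using T.pair_finite_verts finite_subset by blast
  qed
  moreover have "card (g ` I) \<le> card (bag t)" using g calculation(3) by (intro card_mono) auto
  moreover have "card (bag t) \<le> Max ((\<lambda>i. card (bag i)) ` pverts D)"
    using calculation(2) t(1) by (intro Max_ge) auto
  ultimately show ?thesis using w unfolding decomposition_width_def by linarith
qed

text \<open>
  Contracting a matching that leaves out one vertex of each side turns \<open>K\<^bsub>k,k\<^esub>\<close> into
  \<open>K\<^bsub>k+1\<^esub>\<close>.
\<close>

lemma treewidth_ge_bipartite_minor:
  assumes T: "pair_graph T" and K: "card K = k" "k > 0" and disj: "disjoint_family_on C K"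
    and conn: "\<And>a. a \<in> K \<Longrightarrow> connected_in (parcs T) (C a)"
    and KC: "\<And>a. a \<in> K \<Longrightarrow> K \<inter> C a = {}"
    and adj: "\<And>a s. a \<in> K \<Longrightarrow> s \<in> K \<Longrightarrow> \<exists>c \<in> C a. (c, s) \<in> parcs T"
  shows "k \<le> treewidth T"
proof -
  interpret T: pair_graph T by fact
  have sym: "sym (parcs T)" by (auto intro: symI T.arcs_symmetric)
  have adj': "\<exists>c \<in> C a. (s, c) \<in> parcs T" if "a \<in> K" "s \<in> K" for a s
    using adj[OF that] T.arcs_symmetric by blast
  obtain a0 where a0: "a0 \<in> K" using K by fastforce
  have finK: "finite K" using K by (simp add: card_ge_0_finite)
  \<comment> \<open>\<open>None\<close> stands for the unmatched set \<open>C a0\<close>,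
    \<open>Some a0\<close> for the unmatched vertex \<open>a0\<close>, and any other
    \<open>Some a\<close> for the contracted edge between \<open>a\<close> and
    \<open>C a\<close>.\<close>
  define P where "P i = (case i of None \<Rightarrow> C a0 | Some a \<Rightarrow> if a = a0 then {a0} else insert a (C a))" for i
  define I where "I = insert None (Some ` K)"
  have CT: "C a \<subseteq> pverts T" if a: "a \<in> K" for a
  proof
    fix x assume x: "x \<in> C a"
    show "x \<in> pverts T"
    proof (cases "C a = {x}")
      case True
      then show ?thesis using adj[OF a a] T.in_arcsD1 by auto
    next
      case False
      then have "\<exists>y\<in>{x}. \<exists>w\<in>C a - {x}. (y, w) \<in> parcs T"
        using conn[OF a] x by (intro connected_in_cut) auto
      then show ?thesis using T.in_arcsD1 by blast
    qed
  qed
  have KT: "K \<subseteq> pverts T" using adj a0 T.in_arcsD2 by blast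
  show ?thesis
  proof (rule treewidth_ge_minor[OF T, of I k P])
    show "finite I" "card I = Suc k" using finK K unfolding I_def by (auto simp: card_image)
    show "disjoint_family_on P I"
      using disj KC a0 unfolding disjoint_family_on_def I_def P_def by auto
    show "P i \<subseteq> pverts T \<and> connected_in (parcs T) (P i)" if "i \<in> I" for i
    proof (cases i)
      case None
      then show ?thesis using conn CT a0 by (simp add: P_def)
    next
      case (Some a)
      then have a: "a \<in> K" using that unfolding I_def by auto
      obtain c where "c \<in> C a" "(a, c) \<in> parcs T" using adj'[OF a a] by blast
      then have "connected_in (parcs T) (insert a (C a))"
        using conn[OF a] sym by (intro connected_in_insert)
      then show ?thesis using Some a CT KT connected_in_singleton by (auto simp: P_def)
    qed
    show "\<exists>u \<in> P i. \<exists>v \<in> P j. (u, v) \<in> parcs T" if ij: "i \<in> I" "j \<in> I" "i \<noteq> j" for i j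
    proof -
      \<comment> \<open>Every branch set except that of \<open>Some a0\<close> contains some
        \<open>C a\<close>, and every one except that of \<open>None\<close> contains a vertex of
        \<open>K\<close>. Any two distinct branch sets can be assigned these two roles.\<close>
      have *: "\<exists>c \<in> P i. (c, s) \<in> parcs T" if i: "i \<in> I" "i \<noteq> Some a0" "s \<in> K" for i s
      proof -
        obtain a where a: "a \<in> K" "C a \<subseteq> P i"
          using i(1,2) a0 unfolding I_def P_def by (cases i) auto
        show ?thesis using adj[OF a(1) i(3)] a(2) by blast
      qed
      have **: "\<exists>c \<in> P i. (s, c) \<in> parcs T" if "i \<in> I" "i \<noteq> Some a0" "s \<in> K" for i s
        using *[OF that] T.arcs_symmetric by blast
      have ***: "s \<in> P (Some s)" for s unfolding P_def by simp
      show ?thesis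
      proof (cases i)
        case None
        then obtain s where "j = Some s" "s \<in> K" using ij unfolding I_def by auto
        then show ?thesis using *[of i s] ***[of s] None ij by blast
      next
        case (Some s)
        then have s: "s \<in> K" using ij unfolding I_def by auto
        show ?thesis
        proof (cases "j = Some a0")
          case True
          then show ?thesis using *[of i a0] ***[of a0] ij a0 by blast
        next
          case False
          then show ?thesis using **[of j s] ***[of s] ij s Some by blast
        qed
      qed
    qed
  qed
qed

section \<open>Growing deep k-trees\<close>

lemma clique_iff:
  "clique n K G \<longleftrightarrow> K \<subseteq> pverts G \<and> finite K \<and> card K = n \<and>
     (\<forall>u \<in> K. \<forall>v \<in> K. (u, v) \<in> parcs G \<longleftrightarrow> u \<noteq> v)"
proof -
  have eq: "with_proj G \<restriction> K = with_proj \<lparr>pverts = K, parcs = {(u, v) \<in> parcs G. u \<in> K \<and> v \<in> K}\<rparr>"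
    by (auto simp: induce_subgraph_def with_proj_def)
  show ?thesis
    unfolding clique_def eq complete_digraph_pair_def by (auto simp: set_eq_iff)
qed

lemma k_tree_pair_graph: "k_tree k G \<Longrightarrow> pair_graph G"
proof (induction rule: k_tree.induct)
  case (base G)
  then show ?case by (rule pair_graphI_complete)
next
  case (step G K z)
  interpret pair_graph G by fact
  have "finite K" "K \<subseteq> pverts G" using step.hyps(2) by (auto simp: clique_iff)
  then show ?case
    using step.hyps(3) pair_finite_verts pair_finite_arcs arcs_symmetric no_loops'
    by unfold_locales (auto simp: symmetric_def intro!: symI dest: wellformed')
qed

text \<open>
  \<open>G\<close> is an induced subgraph of \<open>G'\<close>, and new vertices are adjacent only to \<open>M\<close> and to each other.
\<close>

definition grows :: "'a pair_pre_digraph \<Rightarrow> 'a set \<Rightarrow> 'a pair_pre_digraph \<Rightarrow> bool" where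
  "grows G M G' \<longleftrightarrow> pverts G \<subseteq> pverts G' \<and> parcs G \<subseteq> parcs G' \<and>
     (\<forall>(u, v) \<in> parcs G' - parcs G.
        {u, v} \<subseteq> pverts G' - pverts G \<union> M \<and> \<not> {u, v} \<subseteq> pverts G)"

lemma grows_subset: "grows G M G' \<Longrightarrow> pverts G \<subseteq> pverts G'" "grows G M G' \<Longrightarrow> parcs G \<subseteq> parcs G'"
  by (simp_all add: grows_def)

lemma grows_new_arc:
  assumes "grows G M G'" "(u, v) \<in> parcs G'" "(u, v) \<notin> parcs G"
  shows "u \<in> pverts G' - pverts G \<union> M" "v \<in> pverts G' - pverts G \<union> M"
    "u \<notin> pverts G \<or> v \<notin> pverts G"
  using assms by (auto simp: grows_def)

lemma grows_old_arc:
  assumes "grows G M G'" "(u, v) \<in> parcs G'" "u \<in> pverts G - M"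
  shows "(u, v) \<in> parcs G"
  using grows_new_arc(1)[OF assms(1,2)] assms(3) by blast

lemma grows_refl: "grows G M G"
  by (simp add: grows_def)

lemma grows_trans:
  assumes "grows G M G1" "grows G1 M1 G2" "M1 \<subseteq> M \<union> (pverts G1 - pverts G)"
  shows "grows G M G2"
proof -
  note sub = grows_subset[OF assms(1)] grows_subset[OF assms(2)]
  have "{u, v} \<subseteq> pverts G2 - pverts G \<union> M \<and> \<not> {u, v} \<subseteq> pverts G"
    if uv: "(u, v) \<in> parcs G2" "(u, v) \<notin> parcs G" for u v
  proof (cases "(u, v) \<in> parcs G1")
    case True
    show ?thesis using grows_new_arc[OF assms(1) True uv(2)] sub by auto
  next
    case False
    show ?thesis using grows_new_arc[OF assms(2) uv(1) False] sub assms(3) by auto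
  qed
  then show ?thesis using sub unfolding grows_def by auto
qed

lemma grows_clique:
  assumes "grows G M G'" "clique n K G"
  shows "clique n K G'"
proof -
  have "(u, v) \<in> parcs G' \<longleftrightarrow> (u, v) \<in> parcs G" if "u \<in> pverts G" "v \<in> pverts G" for u v
    using grows_new_arc(3)[OF assms(1)] grows_subset(2)[OF assms(1)] that by auto
  then show ?thesis
    using assms(2) grows_subset(1)[OF assms(1)] unfolding clique_iff by (auto simp: subset_iff)
qed

section \<open>Pockets in growing graphs\<close>

lemma pocketE:
  assumes "pocket E n K Q"
  obtains z where "z \<in> Q" "{z} \<times> K \<subseteq> E"
    "\<forall>l \<in> K. \<exists>B' \<subseteq> Q - {z}. deep E n (insert z (K - {l})) B'" "K \<inter> Q = {}" "E `` Q \<subseteq> Q \<union> K"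
  using assms unfolding pocket_def by (elim conjE bexE)

text \<open>New arcs could break only the closure of the pockets, which concerns arcs starting in
  \<open>B\<close>, and no such arc is new.\<close>

lemma deep_mono:
  assumes "deep E n K B" "E \<subseteq> E'" "\<And>x y. x \<in> B \<Longrightarrow> (x, y) \<in> E' \<Longrightarrow> (x, y) \<in> E" "B \<subseteq> B2"
  shows "deep E' n K B2"
  using assms
proof (induction n arbitrary: K B B2)
  case 0
  then show ?case by simp
next
  case (Suc n)
  from Suc.prems(1) obtain P where "disjoint_family_on P K \<and> (\<forall>a \<in> K. P a \<subseteq> B \<and> pocket E n K (P a))"
    unfolding deep_Suc ..
  then have P: "disjoint_family_on P K" "\<And>a. a \<in> K \<Longrightarrow> P a \<subseteq> B \<and> pocket E n K (P a)"
    by simp_all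
  have "pocket E' n K (P a)" if a: "a \<in> K" for a
  proof -
    have PB: "P a \<subseteq> B" and pa: "pocket E n K (P a)" using P(2)[OF a] by simp_all
    from pa obtain z where z: "z \<in> P a" "{z} \<times> K \<subseteq> E"
      "\<forall>l \<in> K. \<exists>B' \<subseteq> P a - {z}. deep E n (insert z (K - {l})) B'"
      and Pa: "K \<inter> P a = {}" "E `` P a \<subseteq> P a \<union> K"
      by (rule pocketE)
    have new: "\<exists>B' \<subseteq> P a - {z}. deep E' n (insert z (K - {l})) B'" if l: "l \<in> K" for l
    proof -
      from bspec[OF z(3) l] obtain B' where B': "B' \<subseteq> P a - {z}" "deep E n (insert z (K - {l})) B'" by blast
      have "deep E' n (insert z (K - {l})) B'"
        using B'(2) Suc.prems(2) by (rule Suc.IH) (use B' PB Suc.prems(3) in blast)+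
      then show ?thesis using B' by blast
    qed
    show ?thesis unfolding pocket_def
    proof (intro conjI bexI[of _ z] ballI)
      show "E' `` P a \<subseteq> P a \<union> K" using Pa(2) PB Suc.prems(3) by blast
      show "{z} \<times> K \<subseteq> E'" using z(2) Suc.prems(2) by blast
    qed (use z(1) Pa(1) new in auto)
  qed
  then show ?case unfolding deep_Suc using P Suc.prems(4) by (intro exI[of _ P]) auto
qed

lemma grows_deep:
  assumes "grows G M G'" "deep (parcs G) n K B" "B \<subseteq> pverts G - M"
  shows "deep (parcs G') n K B"
  using assms(2) grows_subset(2)[OF assms(1)]
  by (rule deep_mono) (use assms(3) grows_old_arc[OF assms(1)] in blast)+

lemma grows_pocket:
  assumes "grows G M G'" "pocket (parcs G) n K Q" "Q \<subseteq> pverts G - M"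
  shows "pocket (parcs G') n K Q"
proof -
  from assms(2) obtain z where z: "z \<in> Q" "{z} \<times> K \<subseteq> parcs G"
    "\<forall>l \<in> K. \<exists>B' \<subseteq> Q - {z}. deep (parcs G) n (insert z (K - {l})) B'"
    and Q: "K \<inter> Q = {}" "parcs G `` Q \<subseteq> Q \<union> K"
    by (rule pocketE)
  have new: "\<exists>B' \<subseteq> Q - {z}. deep (parcs G') n (insert z (K - {l})) B'" if "l \<in> K" for l
    using bspec[OF z(3) that] grows_deep[OF assms(1)] assms(3) by (meson Diff_subset order_trans)
  have sub: "parcs G \<subseteq> parcs G'" "parcs G' `` Q \<subseteq> parcs G `` Q"
    using grows_subset(2)[OF assms(1)] grows_old_arc[OF assms(1)] assms(3) by blast+
  show ?thesis unfolding pocket_def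
  proof (intro conjI bexI[of _ z] ballI)
    show "{z} \<times> K \<subseteq> parcs G'" using z(2) sub by blast
    show "parcs G' `` Q \<subseteq> Q \<union> K" using Q(2) sub by blast
  qed (use z(1) Q new in auto)
qed

text \<open>The cliques are treated one after another. Each growth attaches only to its own clique
  inside \<open>pverts G\<close>, so the vertices grown earlier get no new neighbours.\<close>

lemma k_tree_grow_family:
  fixes G :: "'a pair_pre_digraph"
  assumes grow: "\<And>G K. k_tree k G \<Longrightarrow> clique k K G \<Longrightarrow>
      \<exists>G' :: 'a pair_pre_digraph. k_tree k G' \<and> grows G K G' \<and> deep (parcs G') n K (pverts G' - pverts G)"
    and G: "k_tree k G" and "finite F" "\<And>K. K \<in> F \<Longrightarrow> clique k K G \<and> K \<subseteq> M"
  shows "\<exists>G'. k_tree k G' \<and> grows G M G' \<and> (\<forall>K \<in> F. deep (parcs G') n K (pverts G' - pverts G))"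
  using assms(3,4)
proof (induction rule: finite_induct)
  case empty
  then show ?case using G grows_refl by blast
next
  case (insert K F)
  then obtain G1 where G1: "k_tree k G1" "grows G M G1"
    "\<And>K. K \<in> F \<Longrightarrow> deep (parcs G1) n K (pverts G1 - pverts G)"
    by (meson insertCI)
  have K: "clique k K G" "K \<subseteq> M" using insert.prems by blast+
  obtain G2 where G2: "k_tree k G2" "grows G1 K G2" "deep (parcs G2) n K (pverts G2 - pverts G1)"
    using grow[OF G1(1) grows_clique[OF G1(2) K(1)]] by blast
  have "grows G M G2" using G1(2) G2(2) by (rule grows_trans) (use K in blast)
  moreover have sub: "pverts G \<subseteq> pverts G1" "pverts G1 \<subseteq> pverts G2"
    using grows_subset(1) G1(2) G2(2) by blast+
  have "deep (parcs G2) n K' (pverts G2 - pverts G)" if K': "K' \<in> insert K F" for K'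
  proof (cases "K' = K")
    case True
    show ?thesis unfolding True using G2(3) by (rule deep_mono) (use sub in blast)+
  next
    case False
    then have "K' \<in> F" using K' by blast
    moreover have "K \<subseteq> pverts G" using K(1) by (simp add: clique_iff)
    then have "pverts G1 - pverts G \<subseteq> pverts G1 - K" by blast
    ultimately have "deep (parcs G2) n K' (pverts G1 - pverts G)"
      using grows_deep[OF G2(2) G1(3)] by simp
    then show ?thesis by (rule deep_mono) (use sub in blast)+
  qed
  ultimately show ?case using G2(1) by blast
qed

lemma k_tree_add_vertex:
  assumes "k_tree k G" "clique k K G" "z \<notin> pverts G"
  obtains G' where "k_tree k G'" "grows G K G'" "pverts G' = insert z (pverts G)"
    "parcs G' = parcs G \<union> {z} \<times> K \<union> K \<times> {z}"
  using that[OF k_tree.step[OF assms]] assms by (auto simp: grows_def)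

text \<open>Induction on the depth. A pocket consists of an apex on \<open>K\<close> and of what the
  induction hypothesis grows on the cliques obtained by exchanging a vertex of \<open>K\<close> for
  the apex. Vertices are natural numbers, so a fresh one always exists.\<close>

lemma k_tree_grow:
  fixes G :: "nat pair_pre_digraph"
  assumes "k_tree k G" "clique k K G"
  shows "\<exists>G'. k_tree k G' \<and> grows G K G' \<and> deep (parcs G') n K (pverts G' - pverts G)"
  using assms
proof (induction n arbitrary: G K)
  case 0
  then show ?case using grows_refl by fastforce
next
  case (Suc n)
  note K = Suc.prems(2)[unfolded clique_iff]
  \<comment> \<open>The pockets are added one at a time, indexed by a finite set \<open>A\<close>
    that finally becomes \<open>K\<close>.\<close>
  have "\<exists>G' P. k_tree k G' \<and> grows G K G' \<and> disjoint_family_on P A \<and>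
      (\<forall>a \<in> A. P a \<subseteq> pverts G' - pverts G \<and> pocket (parcs G') n K (P a))"
    if "finite A" for A :: "nat set"
    using that
  proof (induction rule: finite_induct)
    case empty
    then show ?case using Suc.prems(1) grows_refl by (auto simp: disjoint_family_on_def)
  next
    case (insert a A)
    from insert.IH obtain G1 P where G1: "k_tree k G1" "grows G K G1" and P: "disjoint_family_on P A"
      "\<forall>a \<in> A. P a \<subseteq> pverts G1 - pverts G \<and> pocket (parcs G1) n K (P a)"
      by (elim exE conjE)
    interpret G1: pair_graph G1 using G1(1) by (rule k_tree_pair_graph)
    obtain z where z: "z \<notin> pverts G1" using G1.pair_finite_verts ex_new_if_finite infinite_UNIV_nat by blast
    have K1: "clique k K G1" using G1(2) Suc.prems(2) by (rule grows_clique)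
    obtain G2 where G2: "k_tree k G2" "grows G1 K G2" "pverts G2 = insert z (pverts G1)"
      "parcs G2 = parcs G1 \<union> {z} \<times> K \<union> K \<times> {z}"
      using k_tree_add_vertex[OF G1(1) K1 z] by blast
    have zK: "z \<notin> K" using z K1 by (auto simp: clique_iff)
    have "clique k (insert z (K - {l})) G2 \<and> insert z (K - {l}) \<subseteq> insert z K" if "l \<in> K" for l
    proof -
      have "card (insert z (K - {l})) = k"
        using K that zK by (metis DiffD1 card_Suc_Diff1 card_insert_disjoint finite_Diff)
      moreover have "(z, z) \<notin> parcs G2" using z zK G2(4) G1.in_arcsD1 by blast
      moreover have "(u, v) \<in> parcs G2 \<longleftrightarrow> u \<noteq> v" if "u \<in> K" "v \<in> K" for u v
        using grows_clique[OF G2(2) K1] that unfolding clique_iff by blast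
      ultimately show ?thesis using K1 G2(3,4) zK unfolding clique_iff by auto
    qed
    then have cl: "clique k K' G2 \<and> K' \<subseteq> insert z K" if "K' \<in> (\<lambda>l. insert z (K - {l})) ` K" for K'
      using that by (elim imageE) simp
    have "\<exists>G3. k_tree k G3 \<and> grows G2 (insert z K) G3 \<and>
        (\<forall>K' \<in> (\<lambda>l. insert z (K - {l})) ` K. deep (parcs G3) n K' (pverts G3 - pverts G2))"
    proof (rule k_tree_grow_family)
      show "finite ((\<lambda>l. insert z (K - {l})) ` K)" using K by simp
    qed (fact Suc.IH G2(1) cl)+
    then obtain G3 where G3: "k_tree k G3" "grows G2 (insert z K) G3"
      "\<forall>K' \<in> (\<lambda>l. insert z (K - {l})) ` K. deep (parcs G3) n K' (pverts G3 - pverts G2)"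
      by (elim exE conjE)
    \<comment> \<open>Relative to \<open>G1\<close> the apex \<open>z\<close> is itself new, so
      growth attached to \<open>insert z K\<close> counts as attached to \<open>K\<close>.\<close>
    have G13: "grows G1 K G3"
      using G2(2) G3(2) by (rule grows_trans) (use z G2(3) in blast)
    have G03: "grows G K G3" using G1(2) G13 by (rule grows_trans) blast
    have sub: "pverts G \<subseteq> pverts G1" "pverts G2 \<subseteq> pverts G3" using grows_subset(1) G1(2) G3(2) by blast+
    define Q where "Q = pverts G3 - pverts G1"
    have "pocket (parcs G3) n K Q"
      unfolding pocket_def
    proof (intro conjI bexI ballI)
      show "K \<inter> Q = {}" using K sub unfolding Q_def by blast
      show "parcs G3 `` Q \<subseteq> Q \<union> K"
      proof clarify
        fix x y assume "x \<in> Q" "(x, y) \<in> parcs G3" "y \<notin> K"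
        then show "y \<in> Q" using grows_new_arc(2)[OF G13] G1.in_arcsD1 unfolding Q_def by blast
      qed
      show zQ: "z \<in> Q" using z G2(3) sub unfolding Q_def by blast
      show "{z} \<times> K \<subseteq> parcs G3" using G2(4) grows_subset(2)[OF G3(2)] by blast
      show "\<exists>B' \<subseteq> Q - {z}. deep (parcs G3) n (insert z (K - {l})) B'" if "l \<in> K" for l
      proof (intro exI conjI)
        show "deep (parcs G3) n (insert z (K - {l})) (pverts G3 - pverts G2)"
          using G3(3) that by simp
        show "pverts G3 - pverts G2 \<subseteq> Q - {z}" using G2(3) unfolding Q_def by blast
      qed
    qed
    moreover have "pocket (parcs G3) n K (P b)" if "b \<in> A" for b
    proof (rule grows_pocket[OF G13])
      show "pocket (parcs G1) n K (P b)" using P(2) that by simp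
      have "P b \<subseteq> pverts G1 - pverts G" using P(2) that by simp
      then show "P b \<subseteq> pverts G1 - K" using K by blast
    qed
    moreover have "P b \<inter> Q = {}" "P b \<subseteq> pverts G3 - pverts G" if "b \<in> A" for b
    proof -
      have "P b \<subseteq> pverts G1 - pverts G" using P(2) that by simp
      then show "P b \<inter> Q = {}" "P b \<subseteq> pverts G3 - pverts G"
        using sub G2(3) unfolding Q_def by blast+
    qed
    moreover have "Q \<subseteq> pverts G3 - pverts G" using sub unfolding Q_def by blast
    ultimately have "disjoint_family_on (P(a := Q)) (insert a A) \<and>
        (\<forall>b \<in> insert a A. (P(a := Q)) b \<subseteq> pverts G3 - pverts G \<and> pocket (parcs G3) n K ((P(a := Q)) b))"
      using P(1) insert.hyps(2) unfolding disjoint_family_on_def by auto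
    then show ?case using G3(1) G03 by (elim conjE) (intro exI conjI)
  qed
  from this[of K] K obtain G' P where G': "k_tree k G'" "grows G K G'" and
    "disjoint_family_on P K \<and> (\<forall>a \<in> K. P a \<subseteq> pverts G' - pverts G \<and> pocket (parcs G') n K (P a))"
    by (elim exE conjE impE) auto
  then have "deep (parcs G') (Suc n) K (pverts G' - pverts G)" unfolding deep_Suc by (intro exI)
  then show ?case using G' by blast
qed

section \<open>Additive spanners of deep k-trees\<close>

lemma relpow_awalk:
  assumes "pair_wf_digraph G" "pre_digraph.awalk (with_proj G) u p v"
  shows "(u, v) \<in> parcs G ^^ length p"
proof -
  interpret pair_wf_digraph G by fact
  show ?thesis using assms(2)
    by (induction p arbitrary: u) (auto simp: awalk_Nil_iff awalk_Cons_iff intro: relpow_Suc_I2 simp del: relpow.simps(2))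
qed

text \<open>Adjacent vertices have distance at most 1 in \<open>G\<close>, hence at most
  \<open>1 + c\<close> in \<open>T\<close>. As \<open>gdist\<close> is an infimum over walks, the
  strict bound \<open>c + 2\<close> is used to extract an actual walk.\<close>

lemma additive_spanner_stretch:
  assumes T: "additive_spanner c T G" and uv: "(u, v) \<in> parcs G"
  shows "\<exists>n \<le> nat \<lceil>c + 2\<rceil>. (u, v) \<in> parcs T ^^ n"
proof -
  have sp: "spanning_subgraph T G" and d: "\<And>u v. u \<in> pverts G \<Longrightarrow> v \<in> pverts G \<Longrightarrow> gdist T u v \<le> gdist G u v + ereal c"
    using T unfolding additive_spanner_def by blast+
  interpret T: pair_graph T using sp unfolding spanning_subgraph_def by blast
  have "wf_digraph (with_proj G)"
    using sp unfolding spanning_subgraph_def spanning_def subgraph_def by blast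
  then interpret G: pair_wf_digraph G by (simp add: wf_digraph_wp_iff)
  have "G.awalk u [(u, v)] v" using uv G.wellformed' by (auto simp: G.awalk_def)
  then have "gdist G u v \<le> ereal 1"
    unfolding gdist_def using G.min_cost_le_walk_cost[of u "[(u, v)]" v "\<lambda>_. 1"] by simp
  then have "gdist T u v \<le> ereal 1 + ereal c"
    using d[of u v] uv G.wellformed' add_right_mono order_trans by blast
  also have "\<dots> < ereal (c + 2)" by simp
  finally obtain p where p: "T.awalk u p v" "T.awalk_cost (\<lambda>_. 1) p < c + 2"
    unfolding gdist_def T.\<mu>_def by (auto simp: INF_less_iff)
  have "T.awalk_cost (\<lambda>_. 1) p = real (length p)"
    by (induction p) auto
  then have "length p \<le> nat \<lceil>c + 2\<rceil>" using p(2) by linarith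
  moreover have "(u, v) \<in> parcs T ^^ length p" using T.pair_wf_digraph p(1) by (rule relpow_awalk)
  ultimately show ?thesis by blast
qed

text \<open>The bound depends only on \<open>card K\<close> and \<open>L\<close>, so the depth of
  the \<open>k\<close>-tree can be fixed before any subgraph \<open>T\<close> is given.\<close>

lemma potential_bound:
  assumes "finite K"
  shows "potential R L K B \<le> card K * card K * (card K * L + 1) + card K * L"
proof -
  have "card (linked R K B) \<le> card (K \<times> K)"
    using assms by (intro card_mono) (auto simp: linked_def)
  then have "card (linked R K B) \<le> card K * card K" by (simp add: card_cartesian_product)
  then show ?thesis unfolding potential_def by (intro add_mono mult_le_mono1) auto
qed

theorem theorem19:
  fixes c :: real and k :: nat
  assumes "c \<ge> 1" and "k \<ge> 3"
  shows "\<exists>G :: nat pair_pre_digraph. k_tree k G \<and>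
           \<not> (\<exists>T. spanning_subgraph T G \<and> treewidth T \<le> k - 1 \<and> additive_spanner c T G)"
proof -
  define L where "L = nat \<lceil>c + 2\<rceil>"
  \<comment> \<open>One more than the value of \<open>potential_bound\<close> for a clique of size
    \<open>k\<close>, so that the initial potential is below the depth.\<close>
  define n where "n = Suc (k * k * (k * L + 1) + k * L)"
  define K where "K = {..<k}"
  define G0 where "G0 = \<lparr>pverts = {..k}, parcs = {(u, v). u \<le> k \<and> v \<le> k \<and> u \<noteq> v}\<rparr>"
  have "k_tree k G0" unfolding G0_def
    by (rule k_tree.base) (auto simp: complete_digraph_pair_def)
  moreover have K0: "clique k K G0" unfolding G0_def K_def clique_iff by auto
  ultimately obtain G where G: "k_tree k G" "grows G0 K G" "deep (parcs G) n K (pverts G - pverts G0)"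
    using k_tree_grow by blast
  interpret G: pair_graph G using G(1) by (rule k_tree_pair_graph)
  have K: "clique k K G" using G(2) K0 by (rule grows_clique)
  have False if sp: "spanning_subgraph T G" and tw: "treewidth T \<le> k - 1" and T: "additive_spanner c T G" for T
  proof (rule deep_contradiction)
    interpret T: pair_graph T using sp unfolding spanning_subgraph_def by blast
    show "sym (parcs T)" by (auto intro: symI T.arcs_symmetric)
    show "sym (parcs G)" by (auto intro: symI G.arcs_symmetric)
    show "parcs T \<subseteq> parcs G"
      using sp unfolding spanning_subgraph_def spanning_def subgraph_def by auto
    show "\<exists>n\<le>L. (u, v) \<in> parcs T ^^ n" if "(u, v) \<in> parcs G" for u v
      unfolding L_def using T that by (rule additive_spanner_stretch)
    show "k > 0" using assms by simp
    show "deep (parcs G) n K (pverts G - pverts G0)" by fact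
    show "card K = k" unfolding K_def by simp
    show "(u, v) \<in> parcs G" if "u \<in> K" "v \<in> K" "u \<noteq> v" for u v
      using K that unfolding clique_iff by blast
    show "potential (parcs T) L K (pverts G - pverts G0) < n"
      using potential_bound[of K "parcs T" L] unfolding n_def K_def by (simp add: less_Suc_eq_le)
    fix K C
    assume "card K = k" "disjoint_family_on C K" "\<And>a. a \<in> K \<Longrightarrow> connected_in (parcs T) (C a)"
      "\<And>a. a \<in> K \<Longrightarrow> K \<inter> C a = {}" "\<And>a s. a \<in> K \<Longrightarrow> s \<in> K \<Longrightarrow> \<exists>c \<in> C a. (c, s) \<in> parcs T"
    then have "k \<le> treewidth T"
      using assms by (intro treewidth_ge_bipartite_minor[OF T.pair_graph]) auto
    then show False using tw assms by simp
  qed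
  then show ?thesis using G(1) by blast
qed

end
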